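(* There exists a finite-unification set ($\mathbf{fus}$) of (multi-headed) existential rules over a signature whose predicates all have arity at most $2$ that is not a finite-cliquewidth set ($\mathbf{fcs}$).
   Context: Instances: countable sets of atoms with constants or nulls as terms; databases: finite instances with only constants; homomorphisms are identity on constants and preserve atoms. An existential rule is $\forall\vec x\forall\vec y(B(\vec x,\vec y)\to\exists\vec z H(\vec y,\vec z))$ with $B,H$ conjunctions of atoms. A model of $(F,\mathcal{R})$ is an instance containing $F$ satisfying all rules; a universal model is a model with a homomorphism into every model. $\mathcal{R}$ is $\mathbf{fus}$ if for every conjunctive query $q(\vec x)$ there is a finite set $\mathcal{Q}$ of conjunctive queries with free variables $\vec x$ such that for every finite instance $F$ and tuple $\vec t$ of its terms, $(F,\mathcal{R})\models q(\vec t)$ iff $F\models q'(\vec t)$ for some $q'\in\mathcal{Q}$. Cliquewidth: for a finite color set $\mathbb{L}$ and finite constant set $\mathrm{Cnst}$, a well-decorated tree labels each node of the infinite binary tree $\{0,1\}^*$ by exactly one of $c_k$ ($c\in\mathrm{Cnst}\cup\{*\}$), $\mathrm{Add}_{R,\vec k}$, $\mathrm{Recolor}_{k\to k'}$, $\oplus$, $\mathrm{Void}$, with: each constant decorated at most once; $\mathrm{Add}$/$\mathrm{Recolor}$ nodes have non-$\mathrm{Void}$ left and $\mathrm{Void}$ right child; $\oplus$ nodes have two non-$\mathrm{Void}$ children; $\mathrm{Void}$ and $c_k$ nodes have $\mathrm{Void}$ children. Node $s$ represents the elements introduced in its subtree ($*_k$ introduces the node itself as a null, $c_k$ the constant $c$),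 colored by introduction color as modified by $\mathrm{Recolor}_{k\to k'}$ nodes on the path up to $s$; $\oplus$ is disjoint union; $\mathrm{Add}_{R,\vec k}$ adds $R(\vec e)$ for all tuples $\vec e$ of its elements colored $\vec k$. $\mathrm{cw}(I)$ is the least $|\mathbb{L}|$ such that some coloring of $I$ is isomorphic to the colored instance represented by a well-decorated tree ($\infty$ if none). $\mathcal{R}$ is $\mathbf{fcs}$ if for every database $\mathcal{D}$ some universal model of $(\mathcal{D},\mathcal{R})$ has finite cliquewidth. *)

theory Defs
  imports "HOL-Library.Extended_Nat"
begin

section \<open>Instances, homomorphisms, rules and queries\<close>

type_synonym const = nat
type_synonym pred = nat
type_synonym var = nat

text \<open>The type of nulls is a parameter because the nulls of an instance represented by a tree
  are the nodes of that tree, whereas ordinary instances use \<^typ>\<open>nat\<close>.\<close>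

datatype 'n trm = Const const | Null 'n

datatype 'a atom = Atom (pred_of: pred) (args: "'a list")

type_synonym signature = "pred \<rightharpoonup> nat"
type_synonym 'n inst = "'n trm atom set"

definition finite_signature :: "signature \<Rightarrow> bool" where
  "finite_signature \<Sigma> \<longleftrightarrow> finite (dom \<Sigma>)"

definition binary_signature :: "signature \<Rightarrow> bool" where
  "binary_signature \<Sigma> \<longleftrightarrow> (\<forall>n \<in> ran \<Sigma>. n \<le> 2)"

definition atom_over :: "signature \<Rightarrow> 'a atom \<Rightarrow> bool" where
  "atom_over \<Sigma> a \<longleftrightarrow> \<Sigma> (pred_of a) = Some (length (args a))"

text \<open>Countability of instances is automatic: every set of atoms over \<^typ>\<open>nat trm\<close> is
  countable.\<close>

definition instance_over :: "signature \<Rightarrow> nat inst \<Rightarrow> bool" where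
  "instance_over \<Sigma> I \<longleftrightarrow> (\<forall>a \<in> I. atom_over \<Sigma> a)"

definition terms :: "'n inst \<Rightarrow> 'n trm set" where
  "terms I = (\<Union>a \<in> I. set (args a))"

definition database :: "signature \<Rightarrow> nat inst \<Rightarrow> bool" where
  "database \<Sigma> D \<longleftrightarrow> finite D \<and> instance_over \<Sigma> D \<and> terms D \<subseteq> range Const"

definition homomorphism :: "('m trm \<Rightarrow> 'n trm) \<Rightarrow> 'm inst \<Rightarrow> 'n inst \<Rightarrow> bool" where
  "homomorphism h I J \<longleftrightarrow> (\<forall>c. h (Const c) = Const c) \<and> map_atom h ` I \<subseteq> J"

text \<open>The universally quantified variables of a rule are those of its body; the existentially
  quantified ones are the variables of the head that do not occur in the body. Bodies may be
  empty.\<close>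

datatype rule = Rule (body: "var atom list") (head: "var atom list")

definition rule_set :: "signature \<Rightarrow> rule set \<Rightarrow> bool" where
  "rule_set \<Sigma> R \<longleftrightarrow> finite R \<and>
     (\<forall>r \<in> R. \<forall>a \<in> set (body r) \<union> set (head r). atom_over \<Sigma> a)"

definition body_vars :: "rule \<Rightarrow> var set" where
  "body_vars r = (\<Union>a \<in> set (body r). set (args a))"

definition conj_holds :: "'n inst \<Rightarrow> (var \<Rightarrow> 'n trm) \<Rightarrow> var atom list \<Rightarrow> bool" where
  "conj_holds I \<sigma> as \<longleftrightarrow> (\<forall>a \<in> set as. map_atom \<sigma> a \<in> I)"

definition satisfies_rule :: "nat inst \<Rightarrow> rule \<Rightarrow> bool" where
  "satisfies_rule I r \<longleftrightarrow> (\<forall>\<sigma>. conj_holds I \<sigma> (body r) \<longrightarrow>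
     (\<exists>\<tau>. (\<forall>x \<in> body_vars r. \<tau> x = \<sigma> x) \<and> conj_holds I \<tau> (head r)))"

definition model :: "signature \<Rightarrow> nat inst \<Rightarrow> rule set \<Rightarrow> nat inst \<Rightarrow> bool" where
  "model \<Sigma> F R I \<longleftrightarrow> instance_over \<Sigma> I \<and> F \<subseteq> I \<and> (\<forall>r \<in> R. satisfies_rule I r)"

definition universal_model :: "signature \<Rightarrow> nat inst \<Rightarrow> rule set \<Rightarrow> nat inst \<Rightarrow> bool" where
  "universal_model \<Sigma> F R U \<longleftrightarrow> model \<Sigma> F R U \<and>
     (\<forall>I. model \<Sigma> F R I \<longrightarrow> (\<exists>h. homomorphism h U I))"

text \<open>The tuple of free variables of a conjunctive query may contain repetitions, as usual for
  answer tuples: this is how a disjunct of a rewriting states the equality of two answers.\<close>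

datatype cq = CQ (free_vars: "var list") (conjuncts: "var atom list")

definition cq_over :: "signature \<Rightarrow> cq \<Rightarrow> bool" where
  "cq_over \<Sigma> q \<longleftrightarrow> (\<forall>a \<in> set (conjuncts q). atom_over \<Sigma> a)"

definition cq_holds :: "nat inst \<Rightarrow> cq \<Rightarrow> nat trm list \<Rightarrow> bool" where
  "cq_holds I q ts \<longleftrightarrow> (\<exists>\<sigma>. map \<sigma> (free_vars q) = ts \<and> conj_holds I \<sigma> (conjuncts q))"

definition entails :: "signature \<Rightarrow> nat inst \<Rightarrow> rule set \<Rightarrow> cq \<Rightarrow> nat trm list \<Rightarrow> bool" where
  "entails \<Sigma> F R q ts \<longleftrightarrow> (\<forall>I. model \<Sigma> F R I \<longrightarrow> cq_holds I q ts)"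

definition fus :: "signature \<Rightarrow> rule set \<Rightarrow> bool" where
  "fus \<Sigma> R \<longleftrightarrow> (\<forall>q. cq_over \<Sigma> q \<longrightarrow>
     (\<exists>Q. finite Q \<and>
        (\<forall>q' \<in> Q. cq_over \<Sigma> q' \<and> length (free_vars q') = length (free_vars q)) \<and>
        (\<forall>F ts. finite F \<and> instance_over \<Sigma> F \<and>
           set ts \<subseteq> terms F \<and> length ts = length (free_vars q) \<longrightarrow>
           (entails \<Sigma> F R q ts \<longleftrightarrow> (\<exists>q' \<in> Q. cq_holds F q' ts)))))"

section \<open>Cliquewidth\<close>

type_synonym color = nat

text \<open>A node of the infinite binary tree is the path leading to it from the root;
  \<open>False\<close> is the left and \<open>True\<close> the right direction.\<close>

type_synonym node = "bool list"

datatype decor =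
    NewNull color
  | NewConst const color
  | Add pred "color list"
  | Recolor color color
  | Oplus
  | Void

type_synonym dtree = "node \<Rightarrow> decor"

fun decor_over :: "signature \<Rightarrow> color set \<Rightarrow> const set \<Rightarrow> decor \<Rightarrow> bool" where
  "decor_over \<Sigma> L C (NewNull k) \<longleftrightarrow> k \<in> L"
| "decor_over \<Sigma> L C (NewConst c k) \<longleftrightarrow> c \<in> C \<and> k \<in> L"
| "decor_over \<Sigma> L C (Add P ks) \<longleftrightarrow> \<Sigma> P = Some (length ks) \<and> set ks \<subseteq> L"
| "decor_over \<Sigma> L C (Recolor k k') \<longleftrightarrow> k \<in> L \<and> k' \<in> L"
| "decor_over \<Sigma> L C Oplus \<longleftrightarrow> True"
| "decor_over \<Sigma> L C Void \<longleftrightarrow> True"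

text \<open>The last two arguments are the decorations of the left and right child.\<close>

fun children_ok :: "decor \<Rightarrow> decor \<Rightarrow> decor \<Rightarrow> bool" where
  "children_ok (NewNull k) l r \<longleftrightarrow> l = Void \<and> r = Void"
| "children_ok (NewConst c k) l r \<longleftrightarrow> l = Void \<and> r = Void"
| "children_ok (Add P ks) l r \<longleftrightarrow> l \<noteq> Void \<and> r = Void"
| "children_ok (Recolor k k') l r \<longleftrightarrow> l \<noteq> Void \<and> r = Void"
| "children_ok Oplus l r \<longleftrightarrow> l \<noteq> Void \<and> r \<noteq> Void"
| "children_ok Void l r \<longleftrightarrow> l = Void \<and> r = Void"

definition well_decorated :: "signature \<Rightarrow> color set \<Rightarrow> const set \<Rightarrow> dtree \<Rightarrow> bool" where
  "well_decorated \<Sigma> L C T \<longleftrightarrow>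
     (\<forall>s. decor_over \<Sigma> L C (T s)) \<and>
     (\<forall>s. children_ok (T s) (T (s @ [False])) (T (s @ [True]))) \<and>
     (\<forall>c s s' k k'. T s = NewConst c k \<and> T s' = NewConst c k' \<longrightarrow> s = s')"

fun recolor :: "decor \<Rightarrow> color \<Rightarrow> color" where
  "recolor (Recolor i j) k = (if k = i then j else k)"
| "recolor _ k = k"

text \<open>\<open>colored T s e k\<close>: the element \<open>e\<close> is introduced in the subtree of \<open>T\<close> rooted at \<open>s\<close> and
  has color \<open>k\<close> in the colored instance represented by \<open>s\<close>. In a well-decorated tree the
  color is unique.\<close>

inductive colored :: "dtree \<Rightarrow> node \<Rightarrow> node trm \<Rightarrow> color \<Rightarrow> bool" for T :: dtree where
  new_null: "T s = NewNull k \<Longrightarrow> colored T s (Null s) k"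
| new_const: "T s = NewConst c k \<Longrightarrow> colored T s (Const c) k"
| child: "colored T (s @ [b]) e k \<Longrightarrow> colored T s e (recolor (T s) k)"

definition elements :: "dtree \<Rightarrow> node \<Rightarrow> node trm set" where
  "elements T s = {e. \<exists>k. colored T s e k}"

text \<open>The atoms represented by \<open>s\<close> are those added at \<open>s\<close> or below; the colors that matter for
  an addition are those at the node where it takes place.\<close>

definition represented :: "dtree \<Rightarrow> node \<Rightarrow> node inst" where
  "represented T s = {Atom P es | P es ks w.
     T (s @ w) = Add P ks \<and> list_all2 (colored T (s @ w)) es ks}"

text \<open>An isomorphism and its inverse both fix constants, hence nulls correspond to nulls. The
  bijection covers all elements introduced in the tree, including those in no atom.\<close>

definition iso_represented :: "nat inst \<Rightarrow> (nat trm \<Rightarrow> color) \<Rightarrow> dtree \<Rightarrow> bool" where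
  "iso_represented I col T \<longleftrightarrow> (\<exists>f.
     bij_betw f (terms I) (elements T []) \<and>
     (\<forall>t \<in> terms I. \<forall>c. f t = Const c \<longleftrightarrow> t = Const c) \<and>
     map_atom f ` I = represented T [] \<and>
     (\<forall>t \<in> terms I. colored T [] (f t) (col t)))"

definition cliquewidth :: "signature \<Rightarrow> nat inst \<Rightarrow> enat" where
  "cliquewidth \<Sigma> I = Inf {enat (card L) | L C T col.
     finite L \<and> finite C \<and> well_decorated \<Sigma> L C T \<and>
     col ` terms I \<subseteq> L \<and> iso_represented I col T}"

definition fcs :: "signature \<Rightarrow> rule set \<Rightarrow> bool" where
  "fcs \<Sigma> R \<longleftrightarrow> (\<forall>D. database \<Sigma> D \<longrightarrow>
     (\<exists>U. universal_model \<Sigma> D R U \<and> cliquewidth \<Sigma> U < \<infinity>))"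

end

theory Submission
  imports Defs "HOL-Library.Countable"
begin

text \<open>The two rules are \<open>A(x) \<rightarrow> \<exists>y. S(x,y) \<and> A(y)\<close> and
  \<open>A(x) \<and> A(y) \<rightarrow> \<exists>z. E(x,z) \<and> E'(z,y)\<close>. Every atom of the Skolem chase depends on at
  most two atoms of the instance, which bounds the size of the queries needed in a rewriting.

  From \<open>A(a)\<close> the rules create a chain \<open>c\<^sub>0, c\<^sub>1, \<dots>\<close> and for all \<open>i, j\<close> an element \<open>p\<^sub>i\<^sub>j\<close> with
  \<open>E(c\<^sub>i, p\<^sub>i\<^sub>j)\<close> and \<open>E'(p\<^sub>i\<^sub>j, c\<^sub>j)\<close>; mapping a universal model to a suitable model shows that these
  are the only such atoms between the \<open>c\<^sub>i\<close> and the \<open>p\<^sub>i\<^sub>j\<close>. A tree with \<open>k\<close> colors has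
  a node with more than \<open>k\<close> of the \<open>c\<^sub>i\<close> below it and more than \<open>k\<close> not below it. Two of those below
  share a color, which forces all \<open>p\<^sub>i\<^sub>j\<close> below for one of them, \<open>c\<^sub>i\<close>. But then two of these \<open>p\<^sub>i\<^sub>j\<close>
  with \<open>c\<^sub>j\<close> not below share a color, a contradiction.\<close>

section \<open>The rule set\<close>

text \<open>The predicates \<open>A, S, E, E'\<close> are numbered 0 to 3.\<close>

definition meet_sig :: signature where
  "meet_sig = [0 \<mapsto> 1, 1 \<mapsto> 2, 2 \<mapsto> 2, 3 \<mapsto> 2]"

definition chain_rule :: rule where
  "chain_rule = Rule [Atom 0 [0]] [Atom 1 [0, 1], Atom 0 [1]]"

definition meet_rule :: rule where
  "meet_rule = Rule [Atom 0 [0], Atom 0 [1]] [Atom 2 [0, 2], Atom 3 [2, 1]]"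

definition meet_rules :: "rule set" where
  "meet_rules = {chain_rule, meet_rule}"

lemma meet_sig_simps [simp]:
  "meet_sig 0 = Some 1" "meet_sig (Suc 0) = Some 2" "meet_sig 2 = Some 2" "meet_sig 3 = Some 2"
  by (auto simp: meet_sig_def)

lemma finite_meet_sig: "finite_signature meet_sig"
  by (auto simp: finite_signature_def meet_sig_def)

lemma binary_meet_sig: "binary_signature meet_sig"
  by (auto simp: binary_signature_def meet_sig_def ran_def)

lemma rule_set_meet_rules: "rule_set meet_sig meet_rules"
  by (auto simp: rule_set_def meet_rules_def chain_rule_def meet_rule_def atom_over_def)

lemma satisfies_chain_rule:
  "satisfies_rule I chain_rule \<longleftrightarrow>
     (\<forall>x. Atom 0 [x] \<in> I \<longrightarrow> (\<exists>y. Atom 1 [x, y] \<in> I \<and> Atom 0 [y] \<in> I))"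
proof
  assume *: "satisfies_rule I chain_rule"
  show "\<forall>x. Atom 0 [x] \<in> I \<longrightarrow> (\<exists>y. Atom 1 [x, y] \<in> I \<and> Atom 0 [y] \<in> I)"
  proof (intro allI impI)
    fix x assume "Atom 0 [x] \<in> I"
    with *[unfolded satisfies_rule_def, rule_format, of "\<lambda>_. x"]
    show "\<exists>y. Atom 1 [x, y] \<in> I \<and> Atom 0 [y] \<in> I"
      by (auto simp: chain_rule_def conj_holds_def body_vars_def)
  qed
next
  assume *: "\<forall>x. Atom 0 [x] \<in> I \<longrightarrow> (\<exists>y. Atom 1 [x, y] \<in> I \<and> Atom 0 [y] \<in> I)"
  show "satisfies_rule I chain_rule"
    unfolding satisfies_rule_def
  proof (intro allI impI)
    fix \<sigma> assume "conj_holds I \<sigma> (body chain_rule)"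
    then obtain y where "Atom 1 [\<sigma> 0, y] \<in> I" "Atom 0 [y] \<in> I"
      using * by (auto simp: chain_rule_def conj_holds_def)
    then show "\<exists>\<tau>. (\<forall>x\<in>body_vars chain_rule. \<tau> x = \<sigma> x) \<and> conj_holds I \<tau> (head chain_rule)"
      by (intro exI[of _ "\<sigma>(1 := y)"]) (auto simp: chain_rule_def conj_holds_def body_vars_def)
  qed
qed

lemma satisfies_meet_rule:
  "satisfies_rule I meet_rule \<longleftrightarrow>
     (\<forall>x y. Atom 0 [x] \<in> I \<and> Atom 0 [y] \<in> I \<longrightarrow>
        (\<exists>z. Atom 2 [x, z] \<in> I \<and> Atom 3 [z, y] \<in> I))"
proof
  assume *: "satisfies_rule I meet_rule"
  show "\<forall>x y. Atom 0 [x] \<in> I \<and> Atom 0 [y] \<in> I \<longrightarrow>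
        (\<exists>z. Atom 2 [x, z] \<in> I \<and> Atom 3 [z, y] \<in> I)"
  proof (intro allI impI)
    fix x y assume "Atom 0 [x] \<in> I \<and> Atom 0 [y] \<in> I"
    with *[unfolded satisfies_rule_def, rule_format, of "(\<lambda>_. x)(1 := y)"]
    show "\<exists>z. Atom 2 [x, z] \<in> I \<and> Atom 3 [z, y] \<in> I"
      by (auto simp: meet_rule_def conj_holds_def body_vars_def)
  qed
next
  assume *: "\<forall>x y. Atom 0 [x] \<in> I \<and> Atom 0 [y] \<in> I \<longrightarrow>
        (\<exists>z. Atom 2 [x, z] \<in> I \<and> Atom 3 [z, y] \<in> I)"
  show "satisfies_rule I meet_rule"
    unfolding satisfies_rule_def
  proof (intro allI impI)
    fix \<sigma> assume "conj_holds I \<sigma> (body meet_rule)"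
    then obtain z where "Atom 2 [\<sigma> 0, z] \<in> I" "Atom 3 [z, \<sigma> 1] \<in> I"
      using * by (auto simp: meet_rule_def conj_holds_def) 
    then show "\<exists>\<tau>. (\<forall>x\<in>body_vars meet_rule. \<tau> x = \<sigma> x) \<and> conj_holds I \<tau> (head meet_rule)"
      by (intro exI[of _ "\<sigma>(2 := z)"]) (auto simp: meet_rule_def conj_holds_def body_vars_def)
  qed
qed

lemma model_meet_rules:
  "model meet_sig F meet_rules I \<longleftrightarrow> instance_over meet_sig I \<and> F \<subseteq> I \<and>
     (\<forall>x. Atom 0 [x] \<in> I \<longrightarrow> (\<exists>y. Atom 1 [x, y] \<in> I \<and> Atom 0 [y] \<in> I)) \<and>
     (\<forall>x y. Atom 0 [x] \<in> I \<and> Atom 0 [y] \<in> I \<longrightarrow>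
        (\<exists>z. Atom 2 [x, z] \<in> I \<and> Atom 3 [z, y] \<in> I))"
  unfolding model_def meet_rules_def
  by (simp add: satisfies_chain_rule satisfies_meet_rule)

section \<open>The Skolem chase and rewritability\<close>

datatype 'a skolem = Link 'a nat | Meet 'a nat 'a nat

text \<open>\<open>Link t n\<close> is the \<open>n\<close>-th chain successor of the given term \<open>t\<close>, and \<open>Meet t n t' n'\<close> the
  witness of the second rule for \<open>Link t n\<close> and \<open>Link t' n'\<close>.\<close>

abbreviation base :: "'a \<Rightarrow> 'a skolem" where
  "base t \<equiv> Link t 0"

text \<open>A closed form of the Skolem chase. All premises are atoms of \<open>F\<close> itself:
  the predicate \<open>A\<close> spreads only along links and never reaches a \<open>Meet\<close>,
  so no rule has to be iterated.\<close>

inductive_set chase :: "'a atom set \<Rightarrow> 'a skolem atom set" for F :: "'a atom set" where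
  given: "a \<in> F \<Longrightarrow> map_atom base a \<in> chase F"
| link: "Atom 0 [t] \<in> F \<Longrightarrow> Atom 0 [Link t n] \<in> chase F"
| succ: "Atom 0 [t] \<in> F \<Longrightarrow> Atom 1 [Link t n, Link t (Suc n)] \<in> chase F"
| left: "Atom 0 [t] \<in> F \<Longrightarrow> Atom 0 [t'] \<in> F \<Longrightarrow>
    Atom 2 [Link t n, Meet t n t' n'] \<in> chase F"
| right: "Atom 0 [t] \<in> F \<Longrightarrow> Atom 0 [t'] \<in> F \<Longrightarrow>
    Atom 3 [Meet t n t' n', Link t' n'] \<in> chase F"

text \<open>The second copy of \<open>succ\<close> matches goals in which simplification has turned
  the predicate \<open>1\<close> into \<open>Suc 0\<close>.\<close>

lemmas chase_intros = chase.intros chase.succ[unfolded One_nat_def]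

text \<open>Polymorphic in the terms, so that \<open>F\<close> can be an instance as well as the set
  of conjuncts of a query over its variables.\<close>

definition derives :: "'a atom set \<Rightarrow> cq \<Rightarrow> 'a list \<Rightarrow> bool" where
  "derives F q ts \<longleftrightarrow> (\<exists>\<sigma>. map \<sigma> (free_vars q) = map base ts \<and>
     map_atom \<sigma> ` set (conjuncts q) \<subseteq> chase F)"

section \<open>Functoriality and universality of the chase\<close>

lemma chase_mono: "F \<subseteq> G \<Longrightarrow> chase F \<subseteq> chase G"
proof
  fix a assume "F \<subseteq> G" "a \<in> chase F"
  from this(2,1) show "a \<in> chase G"
    by induction (auto intro: chase_intros)
qed

lemma atom_map_comp: "map_atom f (map_atom g a) = map_atom (\<lambda>x. f (g x)) a"
  by (cases a) auto

lemma atom_over_map [simp]: "atom_over \<Sigma> (map_atom f a) \<longleftrightarrow> atom_over \<Sigma> a"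
  by (cases a) (auto simp: atom_over_def)

lemma chase_map: "a \<in> chase F \<Longrightarrow> map_atom (map_skolem h) a \<in> chase (map_atom h ` F)"
proof (induction rule: chase.induct)
  case (given a)
  then have "map_atom base (map_atom h a) \<in> chase (map_atom h ` F)"
    by (intro chase.given) auto
  then show ?case by (simp add: atom_map_comp)
qed (auto intro!: chase_intros simp: image_iff, force+)

text \<open>Skolem terms are built uniformly from the given terms, so renaming those carries a match
  along. This turns a derivation from atoms of an instance into one from a query.\<close>

lemma derives_map:
  assumes "derives F q ts"
  shows "derives (map_atom h ` F) q (map h ts)"
proof -
  obtain \<sigma> where "map \<sigma> (free_vars q) = map base ts"
    and c: "map_atom \<sigma> ` set (conjuncts q) \<subseteq> chase F"
    using assms by (auto simp: derives_def)
  then have "map (map_skolem h) (map \<sigma> (free_vars q)) = map base (map h ts)"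
    by simp
  moreover have "map_atom (map_skolem h \<circ> \<sigma>) ` set (conjuncts q) \<subseteq> chase (map_atom h ` F)"
    using chase_map[of _ F h] c by (fastforce simp: atom_map_comp[symmetric] o_def)
  ultimately show ?thesis
    unfolding derives_def by (intro exI[of _ "map_skolem h \<circ> \<sigma>"]) auto
qed

text \<open>The universal property of the chase: choose a successor and a meet witness in
  \<open>J\<close>, iterate the successor along \<open>Link\<close>, and evaluate
  \<open>Meet\<close> by the chosen witness.\<close>

lemma chase_into_model:
  assumes "model meet_sig (map_atom h ` F) meet_rules J"
  obtains g where "\<And>t. g (base t) = h t" "map_atom g ` chase F \<subseteq> J"
proof -
  have F: "map_atom h a \<in> J" if "a \<in> F" for a
    using assms that by (auto simp: model_meet_rules)
  obtain nx where nx: "\<And>x. Atom 0 [x] \<in> J \<Longrightarrow> Atom 1 [x, nx x] \<in> J \<and> Atom 0 [nx x] \<in> J"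
    using assms unfolding model_meet_rules by metis
  obtain mt where mt: "\<And>x y. Atom 0 [x] \<in> J \<Longrightarrow> Atom 0 [y] \<in> J \<Longrightarrow>
      Atom 2 [x, mt x y] \<in> J \<and> Atom 3 [mt x y, y] \<in> J"
    using assms unfolding model_meet_rules by metis
  define g where "g u = (case u of Link t n \<Rightarrow> (nx ^^ n) (h t)
    | Meet t n t' n' \<Rightarrow> mt ((nx ^^ n) (h t)) ((nx ^^ n') (h t')))" for u
  have link: "Atom 0 [(nx ^^ n) (h t)] \<in> J" if "Atom 0 [t] \<in> F" for t n
    using F[OF that] nx by (induction n) auto
  have "map_atom g a \<in> J" if "a \<in> chase F" for a
    using that
  proof cases
    case (given b)
    then show ?thesis using F by (simp add: atom_map_comp g_def)
  qed (use link mt nx in \<open>auto simp: g_def\<close>)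
  then show ?thesis
    by (intro that[of g]) (auto simp: g_def)
qed

text \<open>Compose the match in the chase with the map into \<open>J\<close>. For soundness of the
  rewriting, \<open>F\<close> is the set of conjuncts of a disjunct and \<open>h\<close> a match of
  it.\<close>

lemma derives_sound:
  assumes "derives F q ts" "model meet_sig (map_atom h ` F) meet_rules J"
  shows "cq_holds J q (map h ts)"
proof -
  obtain \<sigma> where \<sigma>: "map \<sigma> (free_vars q) = map base ts"
    "map_atom \<sigma> ` set (conjuncts q) \<subseteq> chase F"
    using assms by (auto simp: derives_def)
  obtain g where g: "\<And>t. g (base t) = h t" "map_atom g ` chase F \<subseteq> J"
    using chase_into_model[OF assms(2)] by blast
  have "map (g \<circ> \<sigma>) (free_vars q) = map g (map \<sigma> (free_vars q))"
    by simp
  then have "map (g \<circ> \<sigma>) (free_vars q) = map h ts"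
    by (simp add: \<sigma>(1) g(1))
  moreover have "conj_holds J (g \<circ> \<sigma>) (conjuncts q)"
    using \<sigma>(2) g(2) by (fastforce simp: conj_holds_def atom_map_comp[symmetric] o_def)
  ultimately show ?thesis
    unfolding cq_holds_def by blast
qed

section \<open>Completeness of the chase\<close>

instance trm :: (countable) countable
  by countable_datatype

instance skolem :: (countable) countable
  by countable_datatype

text \<open>The chase, with its Skolem terms renamed to ordinary terms, is itself a model. An
  entailed query matches there, and the match can be pulled back because the renaming is injective
  on the terms that occur.\<close>

lemma entails_derives:
  assumes fin: "finite F" and over: "instance_over meet_sig F"
    and ent: "entails meet_sig F meet_rules q ts" and ts: "set ts \<subseteq> terms F"
  shows "derives F q ts"
proof -
  have "finite (terms F)"
    using fin by (auto simp: terms_def)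
  then have "finite {n. Null n \<in> terms F}"
    by (rule finite_vimageI[of _ Null, unfolded vimage_def]) (auto intro: injI)
  then obtain m where "{n. Null n \<in> terms F} \<subseteq> {..<m}"
    by (blast dest: finite_nat_bounded)
  then have m: "n < m" if "Null n \<in> terms F" for n
    using that by auto
  \<comment> \<open>Base terms return to themselves; all others become nulls numbered from
    \<open>m\<close> on, which are fresh for \<open>F\<close>.\<close>
  define e :: "nat trm skolem \<Rightarrow> nat trm" where
    "e u = (if \<exists>t. u = base t then (THE t. u = base t) else Null (m + to_nat u))" for u
  have e_base [simp]: "e (base t) = t" for t
    by (auto simp: e_def)
  \<comment> \<open>On all Skolem terms \<open>e\<close> may fail to be injective, as
    \<open>base (Null k)\<close> with \<open>m \<le> k\<close> can collide with a fresh null. Base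
    terms foreign to \<open>F\<close> are therefore excluded.\<close>
  define X where "X = {u. \<forall>t. u = base t \<longrightarrow> t \<in> terms F}"
  have inj: "inj_on e X"
  proof (rule inj_onI)
    fix u v assume uv: "u \<in> X" "v \<in> X" "e u = e v"
    show "u = v"
    proof (cases "\<exists>t. u = base t"; cases "\<exists>t. v = base t")
      assume "\<exists>t. u = base t" "\<nexists>t. v = base t"
      then show ?thesis using uv m by (fastforce simp: X_def e_def)
    next
      assume "\<nexists>t. u = base t" "\<exists>t. v = base t"
      then show ?thesis using uv m by (fastforce simp: X_def e_def)
    next
      assume "\<nexists>t. u = base t" "\<nexists>t. v = base t"
      then have "to_nat u = to_nat v" using uv(3) by (simp add: e_def)
      then show ?thesis by simp
    qed (use uv in auto)
  qed
  have in_X: "set (args a) \<subseteq> X" if "a \<in> chase F" for a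
    using that
  proof cases
    case (given b)
    then show ?thesis by (cases b) (force simp: X_def terms_def)
  qed (force simp: X_def terms_def)+
  define I where "I = map_atom e ` chase F"
  have mapF: "map_atom e (map_atom base a) = a" for a
    by (cases a) (simp add: o_def)
  \<comment> \<open>Both rule bodies consist of \<open>A\<close>-atoms only, so this describes every
    trigger in \<open>I\<close>.\<close>
  have link: "\<exists>t n. x = e (Link t n) \<and> Atom 0 [t] \<in> F" if x: "Atom 0 [x] \<in> I" for x
  proof -
    obtain a where a: "a \<in> chase F" "Atom 0 [x] = map_atom e a"
      using x unfolding I_def by blast
    from a(1) show ?thesis
    proof cases
      case (given b)
      then have "Atom 0 [e (base x)] = map_atom e (map_atom base b)"
        using a(2) by simp
      then have "b = Atom 0 [x]"
        by (simp only: mapF e_base)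
      then show ?thesis using given by (metis e_base)
    qed (use a in auto)
  qed
  have I_intro: "map_atom e a \<in> I" if "a \<in> chase F" for a
    using that by (auto simp: I_def)
  have "model meet_sig F meet_rules I"
    unfolding model_meet_rules
  proof (intro conjI allI impI)
    have "atom_over meet_sig a" if "a \<in> chase F" for a
      using that over by cases (auto simp: instance_over_def, auto simp: atom_over_def)
    then show "instance_over meet_sig I"
      by (auto simp: instance_over_def I_def)
    show "F \<subseteq> I"
      using I_intro[OF chase.given] by (auto simp: mapF)
  next
    fix x assume "Atom 0 [x] \<in> I"
    then obtain t n where "x = e (Link t n)" "Atom 0 [t] \<in> F"
      using link by blast
    then show "\<exists>y. Atom 1 [x, y] \<in> I \<and> Atom 0 [y] \<in> I"
      using I_intro[OF chase.succ[of t F n]] I_intro[OF chase.link[of t F "Suc n"]] by auto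
  next
    fix x y assume "Atom 0 [x] \<in> I \<and> Atom 0 [y] \<in> I"
    then obtain t n t' n' where "x = e (Link t n)" "Atom 0 [t] \<in> F"
      "y = e (Link t' n')" "Atom 0 [t'] \<in> F"
      using link by meson
    then show "\<exists>z. Atom 2 [x, z] \<in> I \<and> Atom 3 [z, y] \<in> I"
      using I_intro[OF chase.left[of t F t' n n']] I_intro[OF chase.right[of t F t' n n']] by auto
  qed
  then obtain \<sigma> where \<sigma>: "map \<sigma> (free_vars q) = ts" "conj_holds I \<sigma> (conjuncts q)"
    using ent by (auto simp: entails_def cq_holds_def)
  define \<tau> where "\<tau> = inv_into X e \<circ> \<sigma>"
  have inv: "inv_into X e (e u) = u" if "u \<in> X" for u
    using inj that by simp
  have "map \<tau> (free_vars q) = map (inv_into X e) ts"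
    using \<sigma>(1) by (auto simp: \<tau>_def)
  also have "\<dots> = map base ts"
    using ts inv[of "base _"] by (auto simp: X_def)
  finally have "map \<tau> (free_vars q) = map base ts" .
  moreover have "map_atom \<tau> a \<in> chase F" if a: "a \<in> set (conjuncts q)" for a
  proof -
    obtain b where b: "b \<in> chase F" "map_atom \<sigma> a = map_atom e b"
      using \<sigma>(2) a unfolding conj_holds_def I_def by blast
    have "map_atom \<tau> a = map_atom (inv_into X e) (map_atom \<sigma> a)"
      by (simp add: \<tau>_def atom_map_comp o_def)
    also have "\<dots> = map_atom (\<lambda>u. inv_into X e (e u)) b"
      by (simp add: b(2) atom_map_comp)
    also have "\<dots> = b"
      using in_X[OF b(1)] by (cases b) (auto intro!: map_idI inv)
    finally show ?thesis using b(1) by simp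
  qed
  ultimately show ?thesis
    unfolding derives_def by blast
qed

section \<open>Bounded support and the finite rewriting\<close>

lemma chase_support:
  assumes "a \<in> chase F"
  obtains G where "G \<subseteq> F" "finite G" "card G \<le> 2" "a \<in> chase G"
  using assms
proof cases
  case (given b)
  then show ?thesis by (intro that[of "{b}"]) (auto intro: chase_intros)
next
  case (link t n)
  then show ?thesis by (intro that[of "{Atom 0 [t]}"]) (auto intro: chase_intros)
next
  case (succ t n)
  then show ?thesis by (intro that[of "{Atom 0 [t]}"]) (auto intro: chase_intros)
next
  case (left t t' n n')
  then show ?thesis
    by (intro that[of "{Atom 0 [t], Atom 0 [t']}"]) (auto intro: chase_intros simp: card_insert_if)
next
  case (right t t' n n')
  then show ?thesis
    by (intro that[of "{Atom 0 [t], Atom 0 [t']}"]) (auto intro: chase_intros simp: card_insert_if)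
qed

text \<open>The union of the supports of the matched conjuncts, at most two atoms for each;
  monotonicity of the chase keeps all of them derivable.\<close>

lemma derives_support:
  assumes "derives F q ts"
  obtains G where "G \<subseteq> F" "finite G" "card G \<le> 2 * length (conjuncts q)" "derives G q ts"
proof -
  obtain \<sigma> where \<sigma>: "map \<sigma> (free_vars q) = map base ts"
    "map_atom \<sigma> ` set (conjuncts q) \<subseteq> chase F"
    using assms by (auto simp: derives_def)
  have "\<exists>G. G \<subseteq> F \<and> finite G \<and> card G \<le> 2 * length as \<and> map_atom \<sigma> ` set as \<subseteq> chase G"
    if "map_atom \<sigma> ` set as \<subseteq> chase F" for as :: "var atom list"
    using that
  proof (induction as)
    case (Cons a as)
    then obtain G where G: "G \<subseteq> F" "finite G" "card G \<le> 2 * length as"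
        "map_atom \<sigma> ` set as \<subseteq> chase G"
      by auto
    obtain H where H: "H \<subseteq> F" "finite H" "card H \<le> 2" "map_atom \<sigma> a \<in> chase H"
      using Cons.prems chase_support[of "map_atom \<sigma> a" F] by auto
    have "card (G \<union> H) \<le> 2 * length (a # as)"
      using card_Un_le[of G H] G(3) H(3) by simp
    moreover have "map_atom \<sigma> ` set (a # as) \<subseteq> chase (G \<union> H)"
      using G(4) H(4) chase_mono[of G "G \<union> H"] chase_mono[of H "G \<union> H"] by auto
    ultimately show ?case using G H by (intro exI[of _ "G \<union> H"]) auto
  qed auto
  then obtain G where "G \<subseteq> F" "finite G" "card G \<le> 2 * length (conjuncts q)"
      "map_atom \<sigma> ` set (conjuncts q) \<subseteq> chase G"
    using \<sigma>(2) by meson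
  with \<sigma>(1) show ?thesis
    by (intro that[of G]) (auto simp: derives_def)
qed

text \<open>The rewriting consists of all bounded-size queries which, read as instances over their
  own variables, derive the query.\<close>

lemma fus_meet_rules: "fus meet_sig meet_rules"
  unfolding fus_def
proof (intro allI impI)
  fix q
  define m where "m = 2 * length (conjuncts q)"
  define n where "n = length (free_vars q)"
  \<comment> \<open>Enough variables for \<open>m\<close> atoms of arity at most 2 together with
    \<open>n\<close> answers.\<close>
  define V where "V = {..<2 * m + n}"
  define A where "A = {a. atom_over meet_sig a \<and> set (args a) \<subseteq> V}"
  define Q where "Q = {q'. set (conjuncts q') \<subseteq> A \<and> length (conjuncts q') \<le> m \<and>
    set (free_vars q') \<subseteq> V \<and> length (free_vars q') = n \<and>
    derives (set (conjuncts q')) q (free_vars q')}"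
  have len: "length (args a) \<le> 2" if "atom_over meet_sig a" for a :: "'b atom"
    using that binary_meet_sig by (auto simp: atom_over_def binary_signature_def ran_def)
  have "A \<subseteq> (\<lambda>(P, es). Atom P es) ` (dom meet_sig \<times> {es. set es \<subseteq> V \<and> length es \<le> 2})"
  proof
    fix a assume "a \<in> A"
    then show "a \<in> (\<lambda>(P, es). Atom P es) ` (dom meet_sig \<times> {es. set es \<subseteq> V \<and> length es \<le> 2})"
      using len[of a] by (cases a) (auto simp: A_def atom_over_def image_iff)
  qed
  then have "finite A"
    by (rule finite_subset)
      (use finite_meet_sig in \<open>auto simp: finite_signature_def V_def intro!: finite_lists_length_le\<close>)
  then have "finite {as. set as \<subseteq> A \<and> length as \<le> m}"
    by (rule finite_lists_length_le)
  moreover have "finite {xs. set xs \<subseteq> V \<and> length xs = n}"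
    by (rule finite_lists_length_eq) (simp add: V_def)
  moreover have "Q \<subseteq> (\<lambda>(xs, as). CQ xs as) `
      ({xs. set xs \<subseteq> V \<and> length xs = n} \<times> {as. set as \<subseteq> A \<and> length as \<le> m})"
  proof
    fix q' assume "q' \<in> Q"
    then show "q' \<in> (\<lambda>(xs, as). CQ xs as) `
      ({xs. set xs \<subseteq> V \<and> length xs = n} \<times> {as. set as \<subseteq> A \<and> length as \<le> m})"
      by (cases q') (auto simp: Q_def image_iff)
  qed
  ultimately have "finite Q"
    by (meson finite_SigmaI finite_imageI finite_subset)
  moreover have "\<forall>q'\<in>Q. cq_over meet_sig q' \<and> length (free_vars q') = length (free_vars q)"
    by (auto simp: Q_def A_def cq_over_def n_def)
  moreover have "entails meet_sig F meet_rules q ts \<longleftrightarrow> (\<exists>q'\<in>Q. cq_holds F q' ts)"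
    if F: "finite F" "instance_over meet_sig F" and ts: "set ts \<subseteq> terms F" "length ts = n"
    for F ts
  proof
    assume "entails meet_sig F meet_rules q ts"
    then have "derives F q ts"
      using entails_derives F ts by blast
    then obtain G where G: "G \<subseteq> F" "finite G" "card G \<le> m" "derives G q ts"
      using derives_support unfolding m_def by metis
    \<comment> \<open>Answers are included because they may occur in no atom of
      \<open>G\<close>.\<close>
    define X where "X = terms G \<union> set ts"
    have "finite X"
      using G(2) by (auto simp: X_def terms_def)
    have "card (set (args a)) \<le> 2" if "a \<in> G" for a
      using that G(1) F(2) len[of a] card_length[of "args a"]
      by (fastforce simp: instance_over_def)
    then have "(\<Sum>a\<in>G. card (set (args a))) \<le> 2 * m"
      using sum_bounded_above[of G "\<lambda>a. card (set (args a))" 2] G(3) by simp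
    then have "card (terms G) \<le> 2 * m"
      unfolding terms_def using card_UN_le[OF G(2), of "\<lambda>a. set (args a)"] by linarith
    then have "card X \<le> 2 * m + n"
      unfolding X_def using card_Un_le[of "terms G" "set ts"] card_length[of ts] ts(2) by linarith
    \<comment> \<open>Numbering the terms reads \<open>G\<close> as a query over \<open>V\<close>;
      the inverse \<open>g\<close> is then its match in \<open>F\<close>.\<close>
    obtain f where f: "bij_betw f X {0..<card X}"
      using ex_bij_betw_finite_nat[OF \<open>finite X\<close>] by blast
    have fV: "f x \<in> V" if "x \<in> X" for x
    proof -
      have "f x \<in> {0..<card X}"
        using that bij_betw_imp_surj_on[OF f] by blast
      then show ?thesis
        using \<open>card X \<le> 2 * m + n\<close> by (simp add: V_def)
    qed
    define g where "g = inv_into X f"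
    have g: "g (f x) = x" if "x \<in> X" for x
      using that f by (auto simp: g_def bij_betw_def)
    obtain as where as: "set as = G" "distinct as"
      using finite_distinct_list[OF G(2)] by blast
    then have las: "length as \<le> m"
      using G(3) by (metis distinct_card)
    define q' where "q' = CQ (map f ts) (map (map_atom f) as)"
    have "derives (map_atom f ` G) q (map f ts)"
      by (rule derives_map) (rule G)
    moreover have "map_atom f a \<in> A" if "a \<in> G" for a
    proof -
      have "set (args a) \<subseteq> X"
        using that by (auto simp: X_def terms_def)
      then show ?thesis
        using that fV G(1) F(2) by (cases a) (fastforce simp: A_def instance_over_def atom_over_def)
    qed
    ultimately have "q' \<in> Q"
      using las as ts(2) fV by (auto simp: Q_def q'_def X_def)
    moreover have "cq_holds F q' ts"
      unfolding cq_holds_def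
    proof (intro exI conjI)
      show "map g (free_vars q') = ts"
        by (auto simp: q'_def X_def intro!: map_idI g)
      have "map_atom g (map_atom f a) = a" if "a \<in> G" for a
      proof -
        have "set (args a) \<subseteq> X"
          using that by (auto simp: X_def terms_def)
        then show ?thesis
          by (cases a) (auto intro!: map_idI g)
      qed
      then show "conj_holds F g (conjuncts q')"
        using G(1) as by (auto simp: conj_holds_def q'_def)
    qed
    ultimately show "\<exists>q'\<in>Q. cq_holds F q' ts"
      by blast
  next
    assume "\<exists>q'\<in>Q. cq_holds F q' ts"
    then obtain q' \<tau> where q': "q' \<in> Q" "map \<tau> (free_vars q') = ts"
      "conj_holds F \<tau> (conjuncts q')"
      by (auto simp: cq_holds_def)
    show "entails meet_sig F meet_rules q ts"
      unfolding entails_def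
    proof (intro allI impI)
      fix J assume "model meet_sig F meet_rules J"
      \<comment> \<open>The image of the disjunct lies in \<open>F\<close>, hence in
        \<open>J\<close>.\<close>
      then have "model meet_sig (map_atom \<tau> ` set (conjuncts q')) meet_rules J"
        using q'(3) by (auto simp: model_def conj_holds_def)
      then show "cq_holds J q ts"
        using q' derives_sound[of "set (conjuncts q')" q "free_vars q'" \<tau> J]
        by (auto simp: Q_def)
    qed
  qed
  ultimately show "\<exists>Q. finite Q \<and>
        (\<forall>q'\<in>Q. cq_over meet_sig q' \<and> length (free_vars q') = length (free_vars q)) \<and>
        (\<forall>F ts. finite F \<and> instance_over meet_sig F \<and> set ts \<subseteq> terms F \<and>
           length ts = length (free_vars q) \<longrightarrow>
           entails meet_sig F meet_rules q ts = (\<exists>q'\<in>Q. cq_holds F q' ts))"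
    unfolding n_def by (intro exI[of _ Q]) simp
qed

section \<open>Separators in well-decorated trees\<close>

definition introduces :: "dtree \<Rightarrow> node \<Rightarrow> node trm \<Rightarrow> bool" where
  "introduces T r e \<longleftrightarrow>
     (\<exists>k. T r = NewNull k \<and> e = Null r \<or> (\<exists>c. T r = NewConst c k \<and> e = Const c))"

text \<open>A null is the very node that introduces it, and a constant decorates at most one
  node.\<close>

lemma introduces_unique:
  assumes "well_decorated \<Sigma> L C T" "introduces T r e" "introduces T r' e"
  shows "r = r'"
  using assms unfolding introduces_def well_decorated_def by (metis trm.inject trm.distinct)

lemma elements_introduced:
  assumes "e \<in> elements T s"
  obtains w where "introduces T (s @ w) e"
proof -
  obtain k where "colored T s e k"
    using assms by (auto simp: elements_def)
  then have "\<exists>w. introduces T (s @ w) e"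
  proof induction
    case (new_null s k)
    then show ?case by (intro exI[of _ "[]"]) (simp add: introduces_def)
  next
    case (new_const s c k)
    then show ?case by (intro exI[of _ "[]"]) (simp add: introduces_def)
  next
    case (child s b e k)
    then show ?case by auto
  qed
  then show ?thesis using that by blast
qed

lemma elements_prefix: "elements T (s @ w) \<subseteq> elements T s"
proof (induction w rule: rev_induct)
  case (snoc b w)
  have "elements T ((s @ w) @ [b]) \<subseteq> elements T (s @ w)"
    using colored.child[of T "s @ w" b] by (force simp: elements_def)
  with snoc show ?case by simp
qed simp

text \<open>Both nodes are prefixes of the single node introducing \<open>e\<close>.\<close>

lemma elements_comparable:
  assumes "well_decorated \<Sigma> L C T" "e \<in> elements T s" "e \<in> elements T t"
  shows "(\<exists>w. s = t @ w) \<or> (\<exists>w. t = s @ w)"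
proof -
  obtain v w where "introduces T (s @ v) e" "introduces T (t @ w) e"
    using assms elements_introduced by metis
  then have "s @ v = t @ w"
    using introduces_unique[OF assms(1)] by blast
  then show ?thesis
    by (auto simp: append_eq_append_conv2)
qed

text \<open>The introducing node is unique, so any two derivations climb the same path and apply the
  same recolorings; a derivation that starts or branches differently would introduce the element
  twice.\<close>

lemma colored_unique:
  assumes wd: "well_decorated \<Sigma> L C T" and "colored T s e k" "colored T s e k'"
  shows "k = k'"
  using assms(2,3)
proof (induction arbitrary: k')
  case (new_null s k)
  then have "introduces T s (Null s)" by (simp add: introduces_def)
  with new_null.prems new_null.hyps show ?case
  proof cases
    case (child b k)
    then have "Null s \<in> elements T (s @ [b])" by (auto simp: elements_def)
    then obtain w where "introduces T ((s @ [b]) @ w) (Null s)"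
      by (rule elements_introduced)
    then show ?thesis
      using introduces_unique[OF wd \<open>introduces T s (Null s)\<close>] by fastforce
  qed auto
next
  case (new_const s c k)
  then have "introduces T s (Const c)" by (simp add: introduces_def)
  with new_const.prems new_const.hyps show ?case
  proof cases
    case (child b k)
    then have "Const c \<in> elements T (s @ [b])" by (auto simp: elements_def)
    then obtain w where "introduces T ((s @ [b]) @ w) (Const c)"
      by (rule elements_introduced)
    then show ?thesis
      using introduces_unique[OF wd \<open>introduces T s (Const c)\<close>] by fastforce
  qed auto
next
  case (child s b e k)
  then have "e \<in> elements T (s @ [b])" by (auto simp: elements_def)
  then obtain w where w: "introduces T ((s @ [b]) @ w) e"
    by (rule elements_introduced)
  note IH = child.IH
  from child.prems show ?case
  proof cases
    case new_null
    then have "introduces T s e" by (simp add: introduces_def)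
    then show ?thesis using introduces_unique[OF wd w] by fastforce
  next
    case (new_const c)
    then have "introduces T s e" by (auto simp: introduces_def)
    then show ?thesis using introduces_unique[OF wd w] by fastforce
  next
    case (child b' k'')
    then have "e \<in> elements T (s @ [b'])" by (auto simp: elements_def)
    then obtain w' where "introduces T ((s @ [b']) @ w') e"
      by (rule elements_introduced)
    then have "b' = b" using introduces_unique[OF wd w] by fastforce
    then show ?thesis using child IH by auto
  qed
qed

lemma colored_in_colors:
  assumes "well_decorated \<Sigma> L C T" "colored T s e k"
  shows "k \<in> L"
  using assms(2)
proof induction
  case (new_null s k)
  then show ?case using assms(1) unfolding well_decorated_def by (metis decor_over.simps(1))
next
  case (new_const s c k)
  then show ?case using assms(1) unfolding well_decorated_def by (metis decor_over.simps(2))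
next
  case (child s b e k)
  have "decor_over \<Sigma> L C (T s)" using assms(1) unfolding well_decorated_def by blast
  then show ?case using child by (cases "T s") auto
qed

text \<open>Each step towards the root applies one recoloring function to both colors.\<close>

lemma same_color_prefix:
  assumes "colored T (t @ w) u k" "colored T (t @ w) v k"
  shows "\<exists>k'. colored T t u k' \<and> colored T t v k'"
  using assms
proof (induction w arbitrary: k rule: rev_induct)
  case (snoc b w)
  then have "colored T (t @ w) u (recolor (T (t @ w)) k)"
    "colored T (t @ w) v (recolor (T (t @ w)) k)"
    using colored.child[of T "t @ w" b] by auto
  then show ?case by (rule snoc.IH)
qed auto

text \<open>An atom linking an element below \<open>s\<close> to one not below \<open>s\<close> is added strictly above \<open>s\<close>,
  where elements with equal colors at \<open>s\<close> can no longer be told apart.\<close>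

lemma represented_exchange:
  assumes wd: "well_decorated \<Sigma> L C T"
    and u: "colored T s u k" and u': "colored T s u' k" and v: "v \<notin> elements T s"
    and rep: "Atom P [u, v] \<in> represented T []"
  shows "Atom P [u', v] \<in> represented T []"
proof -
  obtain t k1 k2 where t: "T t = Add P [k1, k2]" "colored T t u k1" "colored T t v k2"
    using rep by (auto simp: represented_def list_all2_Cons1)
  have "\<nexists>w. t = s @ w"
    using t(3) v elements_prefix[of T s] by (fastforce simp: elements_def)
  then obtain w where w: "s = t @ w"
    using elements_comparable[OF wd, of u s t] u t(2) by (auto simp: elements_def)
  obtain k' where k': "colored T t u k'" "colored T t u' k'"
    using same_color_prefix u u' unfolding w by metis
  then have "colored T t u' k1"
    using colored_unique[OF wd t(2)] by blast
  then show ?thesis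
    using t by (auto simp: represented_def intro!: exI[of _ "[k1, k2]"] exI[of _ t])
qed

text \<open>A node itself introduces at most one element; if it introduces none, \<open>e\<close> is
  arbitrary.\<close>

lemma elements_split:
  "\<exists>e. elements T s \<subseteq> insert e (elements T (s @ [False]) \<union> elements T (s @ [True]))"
proof -
  define N where "N = {e. introduces T s e}"
  have "elements T s \<subseteq> N \<union> (elements T (s @ [False]) \<union> elements T (s @ [True]))"
  proof
    fix e assume "e \<in> elements T s"
    then obtain k where "colored T s e k" by (auto simp: elements_def)
    then show "e \<in> N \<union> (elements T (s @ [False]) \<union> elements T (s @ [True]))"
    proof cases
      case (child b k)
      then show ?thesis by (cases b) (auto simp: elements_def)
    qed (auto simp: N_def introduces_def)
  qed
  moreover have "\<exists>e. N \<subseteq> {e}"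
    by (cases "T s") (auto simp: N_def introduces_def)
  ultimately show ?thesis by fast
qed

text \<open>Take a deepest node with more than \<open>n\<close> elements of \<open>W\<close> below
  it. Each child has at most \<open>n\<close>, so at most \<open>2 * n + 1\<close> lie below the
  node and at least \<open>n + 1\<close> of the \<open>3 * n + 2\<close> remain outside.\<close>

lemma separator:
  assumes wd: "well_decorated \<Sigma> L C T"
    and W: "finite W" "W \<subseteq> elements T []" "card W = 3 * n + 2"
  obtains s where "n < card (W \<inter> elements T s)" "n < card (W - elements T s)"
proof -
  have "\<forall>e\<in>W. \<exists>r. introduces T r e"
    using W(2) elements_introduced by blast
  then obtain r where r: "\<And>e. e \<in> W \<Longrightarrow> introduces T (r e) e"
    by (metis bchoice)
  \<comment> \<open>The tree is infinite; a deepest such node exists because it lies on the path to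
    an element of the finite set \<open>W\<close>.\<close>
  have bound: "length s \<le> (\<Sum>e\<in>W. length (r e))" if "n < card (W \<inter> elements T s)" for s
  proof -
    have "W \<inter> elements T s \<noteq> {}" using that by auto
    then obtain e where e: "e \<in> W" "e \<in> elements T s" by blast
    then obtain w where "introduces T (s @ w) e" using elements_introduced by blast
    then have "r e = s @ w" using introduces_unique[OF wd r] e by blast
    then have "length s \<le> length (r e)" by simp
    also have "\<dots> \<le> (\<Sum>e\<in>W. length (r e))"
      using member_le_sum[of e W "\<lambda>e. length (r e)"] e W(1) by simp
    finally show ?thesis .
  qed
  have "n < card (W \<inter> elements T [])"
    using W by (simp add: Int_absorb2)
  moreover have "\<forall>s. n < card (W \<inter> elements T s) \<longrightarrow> length s < Suc (\<Sum>e\<in>W. length (r e))"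
    using bound by (simp add: less_Suc_eq_le)
  ultimately have "\<exists>s. n < card (W \<inter> elements T s) \<and>
      (\<forall>t. n < card (W \<inter> elements T t) \<longrightarrow> length t \<le> length s)"
    by (rule Lattices_Big.ex_has_greatest_nat)
  then obtain s where s: "n < card (W \<inter> elements T s)"
    and max: "\<And>t. n < card (W \<inter> elements T t) \<Longrightarrow> length t \<le> length s"
    by blast
  have small: "card (W \<inter> elements T (s @ [b])) \<le> n" for b
    using max[of "s @ [b]"] by fastforce
  obtain e where "elements T s \<subseteq> insert e (elements T (s @ [False]) \<union> elements T (s @ [True]))"
    using elements_split by blast
  then have "W \<inter> elements T s \<subseteq>
      insert e (W \<inter> elements T (s @ [False]) \<union> W \<inter> elements T (s @ [True]))"
    by blast
  then have "card (W \<inter> elements T s) \<le>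
      card (insert e (W \<inter> elements T (s @ [False]) \<union> W \<inter> elements T (s @ [True])))"
    using W(1) by (intro card_mono) auto
  also have "\<dots> \<le> Suc (card (W \<inter> elements T (s @ [False])) + card (W \<inter> elements T (s @ [True])))"
    using card_Un_le[of "W \<inter> elements T (s @ [False])" "W \<inter> elements T (s @ [True])"]
    by (metis Suc_le_mono card_insert_le_m1 W(1) card_insert_if finite_Int finite_Un le_SucI)
  also have "\<dots> \<le> 2 * n + 1"
    using small[of False] small[of True] by simp
  finally have "card (W \<inter> elements T s) \<le> 2 * n + 1" .
  moreover have "card (W - elements T s) = card W - card (W \<inter> elements T s)"
    using W(1) by (simp add: card_Diff_subset_Int)
  ultimately have "n < card (W - elements T s)"
    using W(3) by simp
  with s show ?thesis using that by blast
qed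

text \<open>Pigeonhole on indices rather than on elements, so that \<open>f\<close> may have
  repeated values.\<close>

lemma same_color_pair:
  assumes wd: "well_decorated \<Sigma> L C T" and "finite L"
    and X: "card L < card X" and sub: "\<And>i. i \<in> X \<Longrightarrow> f i \<in> elements T s"
  obtains i j k where "i \<in> X" "j \<in> X" "i \<noteq> j" "colored T s (f i) k" "colored T s (f j) k"
proof -
  have "\<forall>i\<in>X. \<exists>k. colored T s (f i) k"
    using sub by (simp add: elements_def)
  then obtain c where c: "\<And>i. i \<in> X \<Longrightarrow> colored T s (f i) (c i)"
    by (metis bchoice)
  then have "c ` X \<subseteq> L"
    using colored_in_colors[OF wd] by blast
  then have "card (c ` X) < card X"
    using card_mono[OF \<open>finite L\<close>, of "c ` X"] X by linarith
  then have "\<not> inj_on c X"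
    by (rule pigeonhole)
  then show ?thesis
    using that c by (metis inj_onI)
qed

lemma no_infinite_meets:
  fixes x :: "nat \<Rightarrow> node trm"
  assumes wd: "well_decorated \<Sigma> L C T" and L: "finite L"
    and x: "inj x" "range x \<subseteq> elements T []"
    and left: "\<And>i j. Atom P [x i, y i j] \<in> represented T []"
    and right: "\<And>i j. Atom Q [y i j, x j] \<in> represented T []"
    and left_unique: "\<And>i j i'. Atom P [x i', y i j] \<in> represented T [] \<Longrightarrow> i' = i"
    and right_unique: "\<And>i j j'. Atom Q [y i j, x j'] \<in> represented T [] \<Longrightarrow> j' = j"
  shows False
proof -
  define N where "N = {..<3 * card L + 2}"
  have "card (x ` N) = 3 * card L + 2"
    using x(1) by (simp add: N_def card_image inj_on_subset)
  moreover have "finite (x ` N)" "x ` N \<subseteq> elements T []"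
    using x(2) by (auto simp: N_def)
  ultimately obtain s where s: "card L < card (x ` N \<inter> elements T s)"
      "card L < card (x ` N - elements T s)"
    using separator[OF wd] by metis
  define X where "X = {i \<in> N. x i \<in> elements T s}"
  define Y where "Y = {i \<in> N. x i \<notin> elements T s}"
  have "x ` N \<inter> elements T s = x ` X" "x ` N - elements T s = x ` Y"
    by (auto simp: X_def Y_def)
  then have card: "card L < card X" "card L < card Y"
    using s x(1) by (simp_all add: card_image inj_on_subset)
  obtain i i' k where i: "i \<in> X" "i \<noteq> i'" "colored T s (x i) k" "colored T s (x i') k"
    using same_color_pair[OF wd L card(1), of x s] unfolding X_def by blast
  \<comment> \<open>Were \<open>y i j\<close> outside, the exchange would also join
    \<open>x i'\<close> to it, against \<open>left_unique\<close>.\<close>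
  have inside: "y i j \<in> elements T s" for j
    using represented_exchange[OF wd i(3,4) _ left] left_unique i(2) by blast
  obtain j j' l where j: "j \<in> Y" "j' \<in> Y" "j \<noteq> j'" "colored T s (y i j) l" "colored T s (y i j') l"
    using same_color_pair[OF wd L card(2), of "y i" s] inside by metis
  \<comment> \<open>The same exchange one level further: \<open>y i j\<close> and
    \<open>y i j'\<close> share a color at \<open>s\<close>, while \<open>x j\<close> is
    outside.\<close>
  have "Atom Q [y i j', x j] \<in> represented T []"
    using represented_exchange[OF wd j(4,5) _ right] j(1) by (auto simp: Y_def)
  then show False
    using right_unique j(3) by blast
qed

section \<open>Universal models have infinite cliquewidth\<close>

text \<open>A single sequence starting with the database constant and running through all
  nulls.\<close>

definition nat_term :: "nat \<Rightarrow> nat trm" where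
  "nat_term n = (case n of 0 \<Rightarrow> Const 0 | Suc m \<Rightarrow> Null m)"

lemma inj_nat_term: "inj nat_term"
  by (auto simp: inj_def nat_term_def split: nat.splits)

text \<open>The meet witnesses are folded into the chain: the one for \<open>i\<close> and
  \<open>j\<close> is the element numbered \<open>prod_encode (i, j)\<close>. This closes the model
  under both rules, and injectivity of the pairing makes a witness determine \<open>i\<close> and
  \<open>j\<close>.\<close>

definition nat_model :: "nat inst" where
  "nat_model = (\<Union>n. {Atom 0 [nat_term n], Atom 1 [nat_term n, nat_term (Suc n)]}) \<union>
     (\<Union>i j. {Atom 2 [nat_term i, nat_term (prod_encode (i, j))],
             Atom 3 [nat_term (prod_encode (i, j)), nat_term j]})"

lemma nat_model_succ: "Atom (Suc 0) [nat_term n, v] \<in> nat_model \<Longrightarrow> v = nat_term (Suc n)"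
  using inj_nat_term by (auto simp: nat_model_def dest: injD)

lemma nat_model_left: "Atom 2 [u, z] \<in> nat_model \<Longrightarrow> Atom 2 [u', z] \<in> nat_model \<Longrightarrow> u = u'"
  using inj_nat_term by (auto simp: nat_model_def dest!: injD)

lemma nat_model_right: "Atom 3 [z, u] \<in> nat_model \<Longrightarrow> Atom 3 [z, u'] \<in> nat_model \<Longrightarrow> u = u'"
  using inj_nat_term by (auto simp: nat_model_def dest!: injD)

lemma model_nat_model: "model meet_sig {Atom 0 [Const 0]} meet_rules nat_model"
  unfolding model_meet_rules
proof (intro conjI allI impI)
  show "instance_over meet_sig nat_model"
    by (auto simp: instance_over_def nat_model_def atom_over_def)
  have "nat_term 0 = Const 0" by (simp add: nat_term_def)
  then show "{Atom 0 [Const 0]} \<subseteq> nat_model"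
    by (auto simp: nat_model_def intro!: exI[of _ 0])
qed (auto simp: nat_model_def)

lemma not_fcs_meet_rules: "\<not> fcs meet_sig meet_rules"
proof
  let ?D = "{Atom 0 [Const 0]} :: nat inst"
  assume "fcs meet_sig meet_rules"
  moreover have "database meet_sig ?D"
    by (auto simp: database_def instance_over_def atom_over_def terms_def)
  ultimately obtain U where U: "universal_model meet_sig ?D meet_rules U"
    and cw: "cliquewidth meet_sig U < \<infinity>"
    unfolding fcs_def by blast
  have mU: "model meet_sig ?D meet_rules U"
    using U by (simp add: universal_model_def)
  obtain g where g: "\<And>c. g (Const c) = Const c" "map_atom g ` U \<subseteq> nat_model"
    using U model_nat_model unfolding universal_model_def homomorphism_def by blast
  have gU: "Atom P (map g es) \<in> nat_model" if "Atom P es \<in> U" for P es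
    using g(2) that by force
  obtain nx where nx: "\<And>u. Atom 0 [u] \<in> U \<Longrightarrow> Atom 1 [u, nx u] \<in> U \<and> Atom 0 [nx u] \<in> U"
    using mU unfolding model_meet_rules by metis
  obtain mt where mt: "\<And>u v. Atom 0 [u] \<in> U \<Longrightarrow> Atom 0 [v] \<in> U \<Longrightarrow>
      Atom 2 [u, mt u v] \<in> U \<and> Atom 3 [mt u v, v] \<in> U"
    using mU unfolding model_meet_rules by metis
  define c where "c n = (nx ^^ n) (Const 0)" for n
  have c: "Atom 0 [c n] \<in> U" for n
    using mU nx by (induction n) (auto simp: c_def model_meet_rules)
  \<comment> \<open>Successors in \<open>nat_model\<close> are unique and the start is a constant,
    so \<open>g\<close> is forced on the chain; in particular the \<open>c n\<close> are
    distinct.\<close>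
  have gc: "g (c n) = nat_term n" for n
  proof (induction n)
    case 0
    then show ?case by (simp add: c_def g nat_term_def)
  next
    case (Suc n)
    have "Atom 1 [c n, c (Suc n)] \<in> U"
      using nx[OF c[of n]] by (simp add: c_def)
    then show ?case
      using gU[of 1 "[c n, c (Suc n)]"] Suc nat_model_succ by simp
  qed
  define p where "p i j = mt (c i) (c j)" for i j
  have p: "Atom 2 [c i, p i j] \<in> U" "Atom 3 [p i j, c j] \<in> U" for i j
    using mt[OF c c] by (auto simp: p_def)
  \<comment> \<open>Uniqueness of endpoints holds in \<open>nat_model\<close> and is pulled back
    along \<open>g\<close>.\<close>
  have left_unique: "i' = i" if "Atom 2 [c i', p i j] \<in> U" for i i' j
    using gU[OF that] gU[OF p(1)[of i j]] nat_model_left injD[OF inj_nat_term]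
    by (fastforce simp: gc)
  have right_unique: "j' = j" if "Atom 3 [p i j, c j'] \<in> U" for i j j'
    using gU[OF that] gU[OF p(2)[of i j]] nat_model_right injD[OF inj_nat_term]
    by (fastforce simp: gc)
  \<comment> \<open>The infimum of the empty set is \<open>\<infinity>\<close>, so finite
    cliquewidth yields an actual tree.\<close>
  have "{enat (card L) | L C T col. finite L \<and> finite C \<and> well_decorated meet_sig L C T \<and>
     col ` terms U \<subseteq> L \<and> iso_represented U col T} \<noteq> {}"
  proof
    assume "{enat (card L) | L C T col. finite L \<and> finite C \<and> well_decorated meet_sig L C T \<and>
     col ` terms U \<subseteq> L \<and> iso_represented U col T} = {}"
    then show False using cw unfolding cliquewidth_def by (simp add: Inf_enat_def)
  qed
  then obtain L C T col where L: "finite L" and wd: "well_decorated meet_sig L C T"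
    and iso: "iso_represented U col T"
    by blast
  obtain f where f: "bij_betw f (terms U) (elements T [])" "map_atom f ` U = represented T []"
    using iso unfolding iso_represented_def by blast
  have inj: "inj_on f (terms U)"
    using f(1) by (simp add: bij_betw_def)
  have terms: "u \<in> terms U" if "Atom P es \<in> U" "u \<in> set es" for P es u
    using that by (force simp: terms_def)
  have ct: "c n \<in> terms U" for n
    using terms[OF c] by simp
  have pt: "p i j \<in> terms U" for i j
    using terms[OF p(1)[of i j], of "p i j"] by simp
  \<comment> \<open>Injectivity of \<open>f\<close> on the terms reflects atoms back to
    \<open>U\<close>, which transfers the uniqueness facts to the tree.\<close>
  have rep: "Atom P [f u, f v] \<in> represented T [] \<longleftrightarrow> Atom P [u, v] \<in> U"
    if uv: "u \<in> terms U" "v \<in> terms U" for P u v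
  proof
    assume "Atom P [f u, f v] \<in> represented T []"
    then obtain a where "a \<in> U" "Atom P [f u, f v] = map_atom f a"
      unfolding f(2)[symmetric] by blast
    then obtain u' v' where a: "Atom P [u', v'] \<in> U" "f u' = f u" "f v' = f v"
      by (cases a) (auto simp: Cons_eq_map_conv)
    then have "u' = u" "v' = v"
      using inj_onD[OF inj] uv terms[OF a(1)] by auto
    then show "Atom P [u, v] \<in> U" using a(1) by simp
  next
    assume "Atom P [u, v] \<in> U"
    then show "Atom P [f u, f v] \<in> represented T []"
      unfolding f(2)[symmetric] by force
  qed
  show False
  proof (rule no_infinite_meets[OF wd L, of "f \<circ> c" 2 "\<lambda>i j. f (p i j)" 3])
    show "inj (f \<circ> c)"
    proof (rule injI)
      fix i j assume "(f \<circ> c) i = (f \<circ> c) j"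
      then have "c i = c j" using inj_onD[OF inj] ct by simp
      then show "i = j" using gc injD[OF inj_nat_term] by metis
    qed
    show "range (f \<circ> c) \<subseteq> elements T []"
      using ct f(1) by (auto simp: bij_betw_def)
  qed (use rep ct pt p left_unique right_unique in auto)
qed

theorem theorem21:
  "\<exists>(\<Sigma> :: signature) (R :: rule set).
     finite_signature \<Sigma> \<and> binary_signature \<Sigma> \<and> rule_set \<Sigma> R \<and>
     fus \<Sigma> R \<and> \<not> fcs \<Sigma> R"
  using finite_meet_sig binary_meet_sig rule_set_meet_rules fus_meet_rules not_fcs_meet_rules
  by blast

end
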